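(* Let $\Pi=\{\pi_1,\pi_2,\ldots,\pi_K\}$ be a finite set of integer partitions with $\pi_1=\emptyset$ (the empty partition), equipped with linking sets $\mathcal{L}(\pi_k)\subseteq\Pi$ such that $\emptyset\in\mathcal{L}(\pi_k)$ for every $k$ and $\mathcal{L}(\emptyset)=\Pi$, and let $S$ be a positive integer no smaller than the largest part among all partitions in $\Pi$. Let $\mathscr{I}=\mathscr{I}(\langle\Pi,\mathcal{L}\rangle,S)$ be the associated span one linked partition ideal. For each $1\le k\le K$, let $\mathscr{I}_k$ be the set of partitions $\lambda\in\mathscr{I}$ whose $S$-tail is $\pi_k$, and put $$\mathscr{G}_k(x)=\mathscr{G}_k(x,q):=\sum_{\lambda\in\mathscr{I}_k}x^{\sharp(\lambda)}q^{|\lambda|}.$$ Let $\mathscr{A}$ be the $K\times K$ $(0,1)$-matrix with $\mathscr{A}_{i,j}=1$ if $\pi_j\in\mathcal{L}(\pi_i)$ and $\mathscr{A}_{i,j}=0$ otherwise, and let $\mathscr{W}(x)=\operatorname{diag}\big(x^{\sharp(\pi_1)}q^{|\pi_1|},\ldots,x^{\sharp(\pi_K)}q^{|\pi_K|}\big)$. Then, for $|q|<1$ and $|x|<|q|^{-1}$, $$\begin{pmatrix}\mathscr{G}_1(x)\\ \vdots\\ \mathscr{G}_K(x)\end{pmatrix}=\mathscr{W}(x)\cdot\left(\lim_{M\to\infty}\mathscr{A}\,\mathscr{W}(xq^{S})\,\mathscr{A}\,\mathscr{W}(xq^{2S})\cdots\mathscr{A}\,\mathscr{W}(xq^{MS})\right)\cdot\begin{pmatrix}1\\0\\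 \vdots\\0\end{pmatrix}.$$
   Context: For a partition $\lambda$, $\sharp(\lambda)$ is its number of parts and $|\lambda|$ its size (sum of parts). The map $\phi$ sends a partition to the partition obtained by adding $1$ to each of its parts, and $\phi^k$ denotes its $k$-fold iterate. For partitions $\lambda,\pi$, $\lambda\oplus\pi$ is the partition in which each integer appears as a part as many times as the total number of its appearances in $\lambda$ and in $\pi$. The span one linked partition ideal $\mathscr{I}(\langle\Pi,\mathcal{L}\rangle,S)$ is the set consisting of the empty partition together with all partitions of the form $\lambda_0\oplus\phi^{S}(\lambda_1)\oplus\phi^{2S}(\lambda_2)\oplus\cdots\oplus\phi^{KS}(\lambda_K)$ arising from finite chains $\lambda_0\to\lambda_1\to\cdots\to\lambda_K$ with $\lambda_0\in\Pi$, $\lambda_K\neq\emptyset$ and $\lambda_k\in\mathcal{L}(\lambda_{k-1})$ for $1\le k\le K$ (such a decomposition is unique). The $S$-tail of a partition $\lambda$ is the collection of parts of $\lambda$ that are $\le S$. *)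

theory Defs
  imports "HOL-Analysis.Analysis" "HOL-Library.Multiset"
begin

text \<open>An integer partition is encoded as the multiset of its parts, so the number of parts of \<open>\<mu>\<close> is \<^term>\<open>size \<mu>\<close>,
  its size is \<^term>\<open>sum_mset \<mu>\<close>, the empty partition is \<^term>\<open>{#}\<close>, and \<open>\<oplus>\<close> is multiset addition.\<close>

definition is_partition :: "nat multiset \<Rightarrow> bool" where
  "is_partition \<mu> \<longleftrightarrow> (\<forall>p \<in># \<mu>. 1 \<le> p)"

definition phi :: "nat multiset \<Rightarrow> nat multiset" where
  "phi \<mu> = image_mset (\<lambda>p. p + 1) \<mu>"

definition span_one_ideal ::
  "nat multiset set \<Rightarrow> (nat multiset \<Rightarrow> nat multiset set) \<Rightarrow> nat \<Rightarrow> nat multiset set" where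
  "span_one_ideal P L S =
     insert {#}
       {(\<Sum>k\<le>N. (phi ^^ (k * S)) (c k)) | c N.
          c 0 \<in> P \<and> c N \<noteq> {#} \<and> (\<forall>k\<in>{1..N}. c k \<in> L (c (k - 1)))}"

definition tail :: "nat \<Rightarrow> nat multiset \<Rightarrow> nat multiset" where
  "tail S \<mu> = filter_mset (\<lambda>p. p \<le> S) \<mu>"

definition ideal_with_tail ::
  "nat multiset set \<Rightarrow> (nat multiset \<Rightarrow> nat multiset set) \<Rightarrow> nat \<Rightarrow> nat multiset
    \<Rightarrow> nat multiset set" where
  "ideal_with_tail P L S \<pi> = {\<mu> \<in> span_one_ideal P L S. tail S \<mu> = \<pi>}"

definition weight :: "complex \<Rightarrow> complex \<Rightarrow> nat multiset \<Rightarrow> complex" where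
  "weight q x \<mu> = x ^ size \<mu> * q ^ sum_mset \<mu>"

definition gen_fun :: "nat multiset set \<Rightarrow> complex \<Rightarrow> complex \<Rightarrow> complex" where
  "gen_fun I q x = (\<Sum>\<^sub>\<infinity>\<mu>\<in>I. weight q x \<mu>)"

text \<open>The enumeration \<open>\<pi>\<^sub>1, \<dots>, \<pi>\<^sub>K\<close> is a function on a finite index type with \<open>K\<close> elements.\<close>

definition link_matrix ::
  "('k::finite \<Rightarrow> nat multiset) \<Rightarrow> (nat multiset \<Rightarrow> nat multiset set) \<Rightarrow> complex ^ 'k ^ 'k" where
  "link_matrix \<pi> L = (\<chi> i j. if \<pi> j \<in> L (\<pi> i) then 1 else 0)"

definition weight_matrix ::
  "('k::finite \<Rightarrow> nat multiset) \<Rightarrow> complex \<Rightarrow> complex \<Rightarrow> complex ^ 'k ^ 'k" where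
  "weight_matrix \<pi> q x = (\<chi> i j. if i = j then weight q x (\<pi> i) else 0)"

primrec link_product ::
  "('k::finite \<Rightarrow> nat multiset) \<Rightarrow> (nat multiset \<Rightarrow> nat multiset set) \<Rightarrow> nat
    \<Rightarrow> complex \<Rightarrow> complex \<Rightarrow> nat \<Rightarrow> complex ^ 'k ^ 'k" where
  "link_product \<pi> L S q x 0 = mat 1"
| "link_product \<pi> L S q x (Suc M) =
     link_product \<pi> L S q x M ** (link_matrix \<pi> L ** weight_matrix \<pi> q (x * q ^ (Suc M * S)))"

end

theory Submission
  imports Defs
begin

text \<open>
  Truncating chains after \<open>M\<close> links, the weights of the partitions with first link \<open>\<pi>\<^sub>k\<close> sum
  to the \<open>k\<close>-th entry of \<open>W(x) P\<^sub>M (1, \<dots>, 1)\<^sup>T\<close>, where \<open>P\<^sub>M\<close> is the \<open>M\<close>-fold product. Since \<open>\<emptyset>\<close>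
  can follow every link and has weight \<open>1\<close>, \<open>P\<^sub>M (1, \<dots>, 1)\<^sup>T\<close> is column \<open>1\<close> of \<open>P\<^bsub>M+1\<^esub>\<close>.
  The other columns of \<open>P\<^sub>M\<close> carry a factor \<open>\<bar>q\<bar>\<^bsup>MS\<^esup>\<close>, so they tend to \<open>0\<close> geometrically and
  column \<open>1\<close> converges. Applied to \<open>\<bar>q\<bar>\<close> and \<open>\<bar>x\<bar>\<close>, the same computation bounds the absolute
  partial sums of the generating functions.
\<close>

section \<open>Shifts of partitions and their weights\<close>

lemma phi_funpow: "(phi ^^ n) \<mu> = image_mset (\<lambda>p. p + n) \<mu>"
  by (induction n) (auto simp: phi_def multiset.map_comp o_def)

lemma phi_funpow_empty [simp]: "(phi ^^ n) {#} = {#}"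
  by (simp add: phi_funpow)

lemma phi_funpow_sum: "(phi ^^ n) (\<Sum>i\<in>I. f i) = (\<Sum>i\<in>I. (phi ^^ n) (f i))"
  by (induction I rule: infinite_finite_induct) (auto simp: phi_funpow)

lemma inj_phi_funpow: "inj (phi ^^ n)"
proof (rule injI)
  fix \<mu> \<nu> assume "(phi ^^ n) \<mu> = (phi ^^ n) \<nu>"
  then have "image_mset (\<lambda>p. p - n) ((phi ^^ n) \<mu>) = image_mset (\<lambda>p. p - n) ((phi ^^ n) \<nu>)"
    by simp
  then show "\<mu> = \<nu>"
    by (simp add: phi_funpow multiset.map_comp o_def)
qed

lemma weight_add: "weight q x (\<mu> + \<nu>) = weight q x \<mu> * weight q x \<nu>"
  by (simp add: weight_def power_add)

text \<open>Raising every part by \<open>n\<close> adds \<open>n\<close> to the size once per part,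
  so the extra power of \<open>q\<close> is absorbed into \<open>x\<close>.\<close>

lemma weight_phi_funpow: "weight q x ((phi ^^ n) \<mu>) = weight q (x * q ^ n) \<mu>"
proof -
  have "sum_mset (image_mset (\<lambda>p. p + n) \<mu>) = sum_mset \<mu> + size \<mu> * n"
    by (induction \<mu>) auto
  then show ?thesis
    by (simp add: weight_def phi_funpow power_add power_mult_distrib power_mult[symmetric] mult_ac)
qed

text \<open>Absolute values of weights are again weights, at the moduli of \<open>q\<close> and
  \<open>x\<close>. Absolute summability thereby reduces to convergence at nonnegative real
  arguments.\<close>

lemma norm_weight: "weight (of_real (norm q)) (of_real (norm x)) \<mu> = of_real (norm (weight q x \<mu>))"
  by (simp add: weight_def norm_mult norm_power)

text \<open>Parts are positive, so the size is at least the number of parts and each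
  \<open>x\<close> can be paired with one \<open>q\<close>. What remains are nonnegative powers of
  \<open>q\<close>; as there is at least one part, the shift contributes at least
  \<open>q ^ n\<close>. The pairing matters because \<open>x\<close> alone may have modulus above
  1.\<close>

lemma norm_weight_shift_le:
  assumes "is_partition \<mu>" "\<mu> \<noteq> {#}" "norm q < 1" "norm (x * q) \<le> 1"
  shows "norm (weight q (x * q ^ n) \<mu>) \<le> norm q ^ n"
proof -
  have size_le: "size \<mu> \<le> sum_mset \<mu>"
    using assms(1) unfolding is_partition_def by (induction \<mu>) auto
  have "weight q (x * q ^ n) \<mu> = (x * q) ^ size \<mu> * q ^ (sum_mset \<mu> - size \<mu>) * q ^ (n * size \<mu>)"
    using power_add[of q "size \<mu>" "sum_mset \<mu> - size \<mu>"] size_le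
    by (simp add: weight_def power_mult_distrib power_mult mult_ac)
  also have "norm \<dots> \<le> 1 * 1 * norm q ^ n"
  proof -
    have "norm ((x * q) ^ size \<mu>) \<le> 1" "norm (q ^ (sum_mset \<mu> - size \<mu>)) \<le> 1"
      using assms(3,4) by (simp_all add: norm_power power_le_one)
    moreover have "norm (q ^ (n * size \<mu>)) \<le> norm q ^ n"
      using assms(2,3) by (auto simp: norm_power Suc_le_eq nonempty_has_size intro!: power_decreasing)
    ultimately show ?thesis
      unfolding norm_mult[of _ "q ^ (n * size \<mu>)"] norm_mult[of "(x * q) ^ size \<mu>"]
      by (intro mult_mono) auto
  qed
  finally show ?thesis by simp
qed

section \<open>Recursions for the matrix product\<close>

text \<open>The definition appends factors on the right, whereas chains are taken apart at their
  first link. Removing the leftmost factor lowers all remaining shifts by \<open>S\<close>, which is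
  compensated by replacing \<open>x\<close> with \<open>x * q ^ S\<close>.\<close>

lemma link_product_Suc_left:
  "link_product \<pi> L S q x (Suc M) =
     link_matrix \<pi> L ** weight_matrix \<pi> q (x * q ^ S) ** link_product \<pi> L S q (x * q ^ S) M"
proof (induction M)
  case 0
  then show ?case by simp
next
  case (Suc M)
  have "x * q ^ (Suc (Suc M) * S) = x * q ^ S * q ^ (Suc M * S)"
    by (simp add: power_add mult_ac)
  then show ?case
    unfolding link_product.simps(2)[of _ _ _ _ _ "Suc M"] Suc.IH
    by (simp only: matrix_mul_assoc link_product.simps(2))
qed

lemma weight_matrix_mult_component: "(weight_matrix \<pi> q x ** A) $ i $ j = weight q x (\<pi> i) * A $ i $ j"
  by (simp add: matrix_matrix_mult_def weight_matrix_def if_distrib[of "\<lambda>a. a * _"] cong: if_cong)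

lemma mult_weight_matrix_component: "(A ** weight_matrix \<pi> q x) $ i $ j = A $ i $ j * weight q x (\<pi> j)"
  by (simp add: matrix_matrix_mult_def weight_matrix_def if_distrib[of "\<lambda>a. _ * a"] cong: if_cong)

lemma link_product_Suc_component:
  "link_product \<pi> L S q x (Suc M) $ i $ j =
     (\<Sum>l\<in>UNIV. link_product \<pi> L S q x M $ i $ l * link_matrix \<pi> L $ l $ j)
       * weight q (x * q ^ (Suc M * S)) (\<pi> j)"
  by (simp add: matrix_mul_assoc mult_weight_matrix_component del: mult_Suc)
     (simp add: matrix_matrix_mult_def)

section \<open>Sums of chains with a fixed number of links\<close>

text \<open>These are the partitions coming from chains that start at \<open>\<mu>\<close> and make
  \<open>M\<close> further steps. Unlike in \<open>span_one_ideal\<close>, the last link may be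
  empty, so a short chain can be padded to any greater length.\<close>

primrec chain_sums ::
  "(nat multiset \<Rightarrow> nat multiset set) \<Rightarrow> nat \<Rightarrow> nat \<Rightarrow> nat multiset \<Rightarrow> nat multiset set" where
  "chain_sums L S 0 \<mu> = {\<mu>}"
| "chain_sums L S (Suc M) \<mu> = (\<Union>\<nu>\<in>L \<mu>. (\<lambda>\<kappa>. \<mu> + (phi ^^ S) \<kappa>) ` chain_sums L S M \<nu>)"

lemma chain_sum_Suc:
  "(\<Sum>k\<le>Suc N. (phi ^^ (k * S)) (c k)) = c 0 + (phi ^^ S) (\<Sum>k\<le>N. (phi ^^ (k * S)) (c (Suc k)))"
  unfolding sum.atMost_Suc_shift phi_funpow_sum
  by (simp add: funpow_add)

lemma chain_sums_memI:
  assumes "\<forall>k\<in>{1..N}. c k \<in> L (c (k - 1))"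
  shows "(\<Sum>k\<le>N. (phi ^^ (k * S)) (c k)) \<in> chain_sums L S N (c 0)"
  using assms
proof (induction N arbitrary: c)
  case 0
  then show ?case by simp
next
  case (Suc N)
  have "c (Suc k) \<in> L (c k)" if "k \<le> N" for k
    using Suc.prems[rule_format, of "Suc k"] that by simp
  then have "(\<Sum>k\<le>N. (phi ^^ (k * S)) (c (Suc k))) \<in> chain_sums L S N (c 1)" "c 1 \<in> L (c 0)"
    using Suc.IH[of "\<lambda>k. c (Suc k)"] by auto
  then show ?case
    unfolding chain_sum_Suc by auto
qed

lemma chain_sums_memE:
  assumes "\<mu> \<in> chain_sums L S N \<nu>"
  obtains c where "c 0 = \<nu>" "\<forall>k\<in>{1..N}. c k \<in> L (c (k - 1))"
    "\<mu> = (\<Sum>k\<le>N. (phi ^^ (k * S)) (c k))"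
  using assms
proof (induction N arbitrary: \<mu> \<nu> thesis)
  case 0
  then show ?case by (auto intro: 0(1)[of "\<lambda>_. \<nu>"])
next
  case (Suc N)
  from Suc.prems(2) obtain \<nu>' \<kappa> where
    \<nu>': "\<nu>' \<in> L \<nu>" and \<kappa>: "\<kappa> \<in> chain_sums L S N \<nu>'" and \<mu>: "\<mu> = \<nu> + (phi ^^ S) \<kappa>"
    by auto
  obtain c where c: "c 0 = \<nu>'" "\<forall>k\<in>{1..N}. c k \<in> L (c (k - 1))"
    "\<kappa> = (\<Sum>k\<le>N. (phi ^^ (k * S)) (c k))"
    using Suc.IH[OF _ \<kappa>] by metis
  show ?case
  proof (rule Suc.prems(1)[of "case_nat \<nu> c"])
    show "\<forall>k\<in>{1..Suc N}. case_nat \<nu> c k \<in> L (case_nat \<nu> c (k - 1))"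
    proof
      fix k assume "k \<in> {1..Suc N}"
      then obtain m where "k = Suc m" "m \<le> N" by (cases k) auto
      then show "case_nat \<nu> c k \<in> L (case_nat \<nu> c (k - 1))"
        using c(1) c(2)[rule_format, of m] \<nu>' by (cases m) auto
    qed
  qed (simp_all only: chain_sum_Suc \<mu> c(3) nat.case)
qed

section \<open>The ideal as an increasing union of finite sets of chain sums\<close>

locale linked_ideal =
  fixes P :: "nat multiset set"
    and \<pi> :: "'k::finite \<Rightarrow> nat multiset"
    and one :: 'k
    and L :: "nat multiset \<Rightarrow> nat multiset set"
    and S :: nat
  assumes inj: "inj \<pi>" and P_eq: "P = range \<pi>"
    and partitions: "\<mu> \<in> P \<Longrightarrow> is_partition \<mu>"
    and one: "\<pi> one = {#}"
    and L_subset: "\<mu> \<in> P \<Longrightarrow> L \<mu> \<subseteq> P"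
    and empty_in_L: "\<mu> \<in> P \<Longrightarrow> {#} \<in> L \<mu>"
    and S_pos: "0 < S"
    and part_le: "\<mu> \<in> P \<Longrightarrow> p \<in># \<mu> \<Longrightarrow> p \<le> S"
begin

abbreviation "X \<equiv> chain_sums L S"

lemma finite_P: "finite P"
  by (simp add: P_eq)

lemma empty_in_P: "{#} \<in> P"
  using one by (metis P_eq rangeI)

lemma finite_L: "\<mu> \<in> P \<Longrightarrow> finite (L \<mu>)"
  using L_subset finite_P finite_subset by blast

lemma finite_chain_sums: "\<mu> \<in> P \<Longrightarrow> finite (X M \<mu>)"
  by (induction M arbitrary: \<mu>) (auto simp: finite_L dest: L_subset[THEN subsetD])

lemma chain_sums_is_partition: "\<mu> \<in> P \<Longrightarrow> \<kappa> \<in> X M \<mu> \<Longrightarrow> is_partition \<kappa>"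
proof (induction M arbitrary: \<mu> \<kappa>)
  case 0
  then show ?case by (simp add: partitions)
next
  case (Suc M)
  then show ?case
    using partitions[of \<mu>] S_pos by (auto simp: is_partition_def phi_funpow)
qed

text \<open>The first link has parts at most \<open>S\<close>, while the parts of the shifted
  remainder are positive numbers plus \<open>S\<close>. Hence the tail recovers the first link,
  which is the source of the uniqueness of decompositions.\<close>

lemma tail_chain_sums:
  assumes "\<mu> \<in> P" "\<kappa> \<in> X M \<mu>"
  shows "tail S \<kappa> = \<mu>"
proof -
  have tail_\<mu>: "tail S \<mu> = \<mu>"
    unfolding tail_def using part_le[OF assms(1)] by (simp add: filter_mset_eq_conv)
  show ?thesis
  proof (cases M)
    case 0
    then show ?thesis using assms tail_\<mu> by simp
  next
    case (Suc N)
    then obtain \<nu> \<kappa>' where \<nu>: "\<nu> \<in> L \<mu>" "\<kappa>' \<in> X N \<nu>" "\<kappa> = \<mu> + (phi ^^ S) \<kappa>'"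
      using assms(2) by auto
    then have "is_partition \<kappa>'"
      using chain_sums_is_partition L_subset[OF assms(1)] by blast
    then have "tail S ((phi ^^ S) \<kappa>') = {#}"
      unfolding tail_def is_partition_def phi_funpow by (auto simp: filter_mset_eq_conv)
    then show ?thesis
      using \<nu>(3) tail_\<mu> by (simp add: tail_def)
  qed
qed

text \<open>Every chain can be prolonged by the empty partition, which leaves its sum
  unchanged.\<close>

lemma chain_sums_Suc_mono: "\<mu> \<in> P \<Longrightarrow> X M \<mu> \<subseteq> X (Suc M) \<mu>"
proof (induction M arbitrary: \<mu>)
  case 0
  then show ?case using empty_in_L by force
next
  case (Suc M)
  show ?case
  proof
    fix \<kappa> assume "\<kappa> \<in> X (Suc M) \<mu>"
    then obtain \<nu> \<kappa>' where "\<nu> \<in> L \<mu>" "\<kappa>' \<in> X M \<nu>" "\<kappa> = \<mu> + (phi ^^ S) \<kappa>'"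
      by auto
    moreover from this have "\<kappa>' \<in> X (Suc M) \<nu>"
      using Suc.IH L_subset[OF Suc.prems] by blast
    ultimately show "\<kappa> \<in> X (Suc (Suc M)) \<mu>"
      unfolding chain_sums.simps(2)[of L S "Suc M"] by blast
  qed
qed

lemma chain_sums_mono: "\<mu> \<in> P \<Longrightarrow> M \<le> N \<Longrightarrow> X M \<mu> \<subseteq> X N \<mu>"
  using chain_sums_Suc_mono by (rule lift_Suc_mono_le)

lemma chain_sums_subset_ideal:
  assumes "\<mu> \<in> P" "\<kappa> \<in> X M \<mu>"
  shows "\<kappa> \<in> span_one_ideal P L S"
proof -
  obtain c where c: "c 0 = \<mu>" "\<forall>k\<in>{1..M}. c k \<in> L (c (k - 1))"
    "\<kappa> = (\<Sum>k\<le>M. (phi ^^ (k * S)) (c k))"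
    using chain_sums_memE[OF assms(2)] by metis
  show ?thesis
  proof (cases "\<forall>k\<le>M. c k = {#}")
    case True
    then have "\<kappa> = {#}" unfolding c(3) by simp
    then show ?thesis by (simp add: span_one_ideal_def)
  next
    case False
    \<comment> \<open>\<open>N\<close> is the index of the last nonempty link. Cutting the chain
      there removes only empty summands and yields the nonempty last link that
      \<open>span_one_ideal\<close> demands.\<close>
    define N where "N = Max {k. k \<le> M \<and> c k \<noteq> {#}}"
    have N: "N \<le> M" "c N \<noteq> {#}"
      using Max_in[of "{k. k \<le> M \<and> c k \<noteq> {#}}"] False unfolding N_def by auto
    have "c k = {#}" if "N < k" "k \<le> M" for k
    proof (rule ccontr)
      assume "c k \<noteq> {#}"
      then have "k \<le> N"
        unfolding N_def using that(2) by (intro Max_ge) auto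
      then show False
        using that(1) by simp
    qed
    then have "\<kappa> = (\<Sum>k\<le>N. (phi ^^ (k * S)) (c k))"
      unfolding c(3) using N(1) by (intro sum.mono_neutral_right) auto
    moreover have "\<forall>k\<in>{1..N}. c k \<in> L (c (k - 1))"
      using c(2) N(1) by auto
    ultimately show ?thesis
      using c(1) assms(1) N(2) unfolding span_one_ideal_def by blast
  qed
qed

lemma ideal_with_tail_eq:
  assumes "\<mu> \<in> P"
  shows "ideal_with_tail P L S \<mu> = (\<Union>M. X M \<mu>)"
proof (intro equalityI subsetI)
  fix \<kappa> assume "\<kappa> \<in> ideal_with_tail P L S \<mu>"
  then have \<kappa>: "\<kappa> \<in> span_one_ideal P L S" and tail: "tail S \<kappa> = \<mu>"
    by (auto simp: ideal_with_tail_def)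
  obtain \<nu> M where \<nu>: "\<nu> \<in> P" "\<kappa> \<in> X M \<nu>"
  proof (cases "\<kappa> = {#}")
    case True
    \<comment> \<open>The empty partition belongs to the ideal by a separate clause; here it is the
      chain consisting of the single link \<open>{#}\<close>.\<close>
    then show ?thesis using that[of "{#}" 0] empty_in_P by simp
  next
    case False
    then obtain c N where "c 0 \<in> P" "\<forall>k\<in>{1..N}. c k \<in> L (c (k - 1))"
      "\<kappa> = (\<Sum>k\<le>N. (phi ^^ (k * S)) (c k))"
      using \<kappa> unfolding span_one_ideal_def by blast
    then show ?thesis using that chain_sums_memI by metis
  qed
  then show "\<kappa> \<in> (\<Union>M. X M \<mu>)"
    using tail_chain_sums tail by blast
next
  fix \<kappa> assume "\<kappa> \<in> (\<Union>M. X M \<mu>)"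
  then show "\<kappa> \<in> ideal_with_tail P L S \<mu>"
    using chain_sums_subset_ideal tail_chain_sums assms by (auto simp: ideal_with_tail_def)
qed

section \<open>Finite weight sums as row sums of the matrix product\<close>

text \<open>The chains are sorted by their second link. Different second links give disjoint sets
  because the tail identifies them, and prepending \<open>\<mu>\<close> after a shift is injective,
  so no partition is counted twice.\<close>

lemma sum_weight_chain_sums_Suc:
  assumes "\<mu> \<in> P"
  shows "sum (weight q x) (X (Suc M) \<mu>) =
    weight q x \<mu> * (\<Sum>\<nu>\<in>L \<mu>. sum (weight q (x * q ^ S)) (X M \<nu>))"
proof -
  define f where "f = (\<lambda>\<kappa>. \<mu> + (phi ^^ S) \<kappa>)"
  have inj_f: "inj f"
    using inj_phi_funpow[of S] by (auto simp: f_def inj_def)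
  have disj: "X M \<nu> \<inter> X M \<nu>' = {}" if "\<nu> \<in> L \<mu>" "\<nu>' \<in> L \<mu>" "\<nu> \<noteq> \<nu>'" for \<nu> \<nu>'
    using tail_chain_sums that L_subset[OF assms] by blast
  have "X (Suc M) \<mu> = (\<Union>\<nu>\<in>L \<mu>. f ` X M \<nu>)"
    by (simp add: f_def)
  also have "sum (weight q x) \<dots> = (\<Sum>\<nu>\<in>L \<mu>. sum (weight q x) (f ` X M \<nu>))"
  proof (rule sum.UNION_disjoint)
    show "\<forall>\<nu>\<in>L \<mu>. \<forall>\<nu>'\<in>L \<mu>. \<nu> \<noteq> \<nu>' \<longrightarrow> f ` X M \<nu> \<inter> f ` X M \<nu>' = {}"
      using disj by (simp add: image_Int[OF inj_f, symmetric])
  qed (use assms finite_L finite_chain_sums L_subset in blast)+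
  also have "\<dots> = (\<Sum>\<nu>\<in>L \<mu>. \<Sum>\<kappa>\<in>X M \<nu>. weight q x (f \<kappa>))"
    using inj_f by (simp add: sum.reindex inj_on_subset[of f UNIV])
  finally show ?thesis
    by (simp add: f_def weight_add weight_phi_funpow sum_distrib_left)
qed

lemma sum_L: "(\<Sum>\<nu>\<in>L (\<pi> k). f \<nu>) = (\<Sum>j\<in>UNIV. link_matrix \<pi> L $ k $ j * f (\<pi> j))"
proof -
  have "L (\<pi> k) = \<pi> ` {j. \<pi> j \<in> L (\<pi> k)}"
    using L_subset[of "\<pi> k"] by (auto simp: P_eq)
  then have "(\<Sum>\<nu>\<in>L (\<pi> k). f \<nu>) = (\<Sum>j | \<pi> j \<in> L (\<pi> k). f (\<pi> j))"
    using inj by (metis (mono_tags, lifting) inj_on_subset subset_UNIV sum.reindex_cong)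
  also have "\<dots> = (\<Sum>j\<in>UNIV. link_matrix \<pi> L $ k $ j * f (\<pi> j))"
    by (simp add: link_matrix_def if_distrib[of "\<lambda>a. a * _"] sum.If_cases cong: if_cong)
  finally show ?thesis .
qed

text \<open>Splitting off the first link on both sides gives the same recursion. The induction keeps
  \<open>x\<close> arbitrary because the remainder is evaluated at \<open>x * q ^ S\<close>.\<close>

lemma sum_weight_chain_sums:
  "sum (weight q x) (X M (\<pi> k)) = weight q x (\<pi> k) * (\<Sum>j\<in>UNIV. link_product \<pi> L S q x M $ k $ j)"
proof (induction M arbitrary: x k)
  case 0
  then show ?case by (simp add: mat_def)
next
  case (Suc M)
  have "(\<Sum>j\<in>UNIV. link_product \<pi> L S q x (Suc M) $ k $ j) =
     (\<Sum>j\<in>UNIV. \<Sum>i\<in>UNIV. link_matrix \<pi> L $ k $ i *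
        (weight q (x * q ^ S) (\<pi> i) * link_product \<pi> L S q (x * q ^ S) M $ i $ j))"
    unfolding link_product_Suc_left matrix_mul_assoc[symmetric]
    by (subst matrix_matrix_mult_def) (simp add: weight_matrix_mult_component)
  also have "\<dots> = (\<Sum>\<nu>\<in>L (\<pi> k). sum (weight q (x * q ^ S)) (X M \<nu>))"
    unfolding sum_L Suc.IH by (subst sum.swap) (simp add: sum_distrib_left)
  finally show ?case
    by (subst sum_weight_chain_sums_Suc) (auto simp: P_eq)
qed

lemma link_matrix_one: "link_matrix \<pi> L $ i $ one = 1"
  using empty_in_L[of "\<pi> i"] by (simp add: link_matrix_def one P_eq)

text \<open>Column \<open>one\<close> of the link matrix consists of ones and the weight of the
  empty partition is 1, so the new factor just adds up the row.\<close>

lemma link_product_Suc_one: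
  "link_product \<pi> L S q x (Suc M) $ i $ one = (\<Sum>l\<in>UNIV. link_product \<pi> L S q x M $ i $ l)"
  unfolding link_product_Suc_component by (simp add: link_matrix_one one weight_def)

lemma norm_link_matrix_le: "norm (link_matrix \<pi> L $ i $ j) \<le> 1"
  by (simp add: link_matrix_def)

section \<open>Convergence of the matrix product\<close>

context
  fixes q x :: complex
  assumes q: "norm q < 1" and xq: "norm (x * q) \<le> 1"
begin

text \<open>By injectivity of the enumeration, an index other than \<open>one\<close> stands for a
  nonempty partition. Its weight in the last diagonal factor then supplies the power of
  \<open>norm q\<close>.\<close>

lemma norm_link_product_Suc_le:
  assumes "j \<noteq> one"
  shows "norm (link_product \<pi> L S q x (Suc M) $ i $ j) \<le>
    (\<Sum>l\<in>UNIV. norm (link_product \<pi> L S q x M $ i $ l)) * (norm q ^ S) ^ Suc M"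
proof -
  have "\<pi> j \<noteq> {#}"
    using assms inj one by (metis injD)
  then have "norm (weight q (x * q ^ (Suc M * S)) (\<pi> j)) \<le> norm q ^ (Suc M * S)"
    using partitions[of "\<pi> j"] q xq by (intro norm_weight_shift_le) (auto simp: P_eq)
  moreover have "norm (\<Sum>l\<in>UNIV. link_product \<pi> L S q x M $ i $ l * link_matrix \<pi> L $ l $ j)
      \<le> (\<Sum>l\<in>UNIV. norm (link_product \<pi> L S q x M $ i $ l))"
    by (intro sum_norm_le) (simp add: norm_mult mult_left_le norm_link_matrix_le)
  ultimately show ?thesis
    unfolding link_product_Suc_component norm_mult
    by (simp only: power_mult[symmetric] mult.commute[of S])
       (intro mult_mono, auto intro: sum_nonneg)
qed

text \<open>Passing from \<open>M\<close> to \<open>Suc M\<close>, column \<open>one\<close>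
  contributes at most the old row sum and each other column at most that sum times
  \<open>\<rho> ^ Suc M\<close>. The row sum thus grows by factors
  \<open>1 + K * \<rho> ^ Suc M\<close>, whose product stays bounded because the geometric series
  converges.\<close>

lemma link_product_row_bounded:
  obtains B where "0 \<le> B" "\<And>M. (\<Sum>l\<in>UNIV. norm (link_product \<pi> L S q x M $ i $ l)) \<le> B"
proof -
  define s where "s M = (\<Sum>l\<in>UNIV. norm (link_product \<pi> L S q x M $ i $ l))" for M
  define \<rho> where "\<rho> = norm q ^ S"
  define K where "K = real CARD('k)"
  have \<rho>: "0 \<le> \<rho>" "\<rho> < 1"
    using q S_pos by (auto simp: \<rho>_def power_less_one_iff)
  have s_nonneg: "0 \<le> s M" for M
    by (simp add: s_def sum_nonneg)
  have step: "s (Suc M) \<le> s M * (1 + K * \<rho> ^ Suc M)" for M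
  proof -
    have "s (Suc M) = norm (link_product \<pi> L S q x (Suc M) $ i $ one) +
        (\<Sum>l\<in>UNIV - {one}. norm (link_product \<pi> L S q x (Suc M) $ i $ l))"
      unfolding s_def by (rule sum.remove) auto
    also have "\<dots> \<le> s M + (\<Sum>l\<in>UNIV - {one}. s M * \<rho> ^ Suc M)"
      unfolding s_def \<rho>_def
      by (intro add_mono sum_mono norm_link_product_Suc_le)
         (auto simp del: link_product.simps simp: link_product_Suc_one norm_sum)
    \<comment> \<open>Counting all \<open>K\<close> columns instead of \<open>K - 1\<close> only
      weakens the bound and simplifies the constant.\<close>
    also have "\<dots> \<le> s M + (\<Sum>l\<in>(UNIV::'k set). s M * \<rho> ^ Suc M)"
      using s_nonneg \<rho>(1) by (intro add_left_mono sum_mono2) auto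
    finally show ?thesis
      by (simp add: K_def algebra_simps)
  qed
  have "s M \<le> s 0 * exp (K * (\<Sum>m<M. \<rho> ^ Suc m))" for M
  proof (induction M)
    case (Suc M)
    have "s (Suc M) \<le> s M * (1 + K * \<rho> ^ Suc M)"
      by (rule step)
    \<comment> \<open>The new factor is estimated by 1 + t \<le> exp t, turning the product into the
      exponential of a partial sum.\<close>
    also have "\<dots> \<le> (s 0 * exp (K * (\<Sum>m<M. \<rho> ^ Suc m))) * exp (K * \<rho> ^ Suc M)"
      using Suc.IH s_nonneg \<rho>(1) by (intro mult_mono) (auto simp: K_def)
    also have "\<dots> = s 0 * exp (K * (\<Sum>m<Suc M. \<rho> ^ Suc m))"
      by (simp add: distrib_left exp_add mult.assoc)
    finally show ?case .
  qed simp
  moreover have "(\<Sum>m<M. \<rho> ^ Suc m) \<le> (\<Sum>m. \<rho> ^ Suc m)" for M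
    using \<rho> by (intro sum_le_suminf) (auto simp: summable_mult summable_geometric)
  ultimately have "s M \<le> s 0 * exp (K * (\<Sum>m. \<rho> ^ Suc m))" for M
    using s_nonneg[of 0] by (smt (verit) K_def exp_le_cancel_iff mult_left_mono of_nat_0_le_iff)
  then show ?thesis
    using that s_nonneg[of 0] unfolding s_def by (meson exp_ge_zero mult_nonneg_nonneg)
qed

text \<open>Bounded row sums turn the estimate for a column other than \<open>one\<close> into a
  geometric majorant. Summability, rather than mere convergence to 0, is what controls column
  \<open>one\<close> below.\<close>

lemma summable_link_product_column:
  assumes "j \<noteq> one"
  shows "summable (\<lambda>M. link_product \<pi> L S q x M $ i $ j)"
proof -
  obtain B where B: "0 \<le> B" "\<And>M. (\<Sum>l\<in>UNIV. norm (link_product \<pi> L S q x M $ i $ l)) \<le> B"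
    using link_product_row_bounded by blast
  define \<rho> where "\<rho> = norm q ^ S"
  have \<rho>: "0 \<le> \<rho>" "\<rho> < 1"
    using q S_pos by (auto simp: \<rho>_def power_less_one_iff)
  have "summable (\<lambda>M. link_product \<pi> L S q x (Suc M) $ i $ j)"
  proof (rule summable_comparison_test')
    show "summable (\<lambda>M. B * \<rho> ^ Suc M)"
      using \<rho> by (intro summable_mult) (simp add: summable_mult summable_geometric)
    show "norm (link_product \<pi> L S q x (Suc M) $ i $ j) \<le> B * \<rho> ^ Suc M" for M
      using order_trans[OF norm_link_product_Suc_le[OF assms] mult_right_mono[OF B(2)]] \<rho>(1)
      unfolding \<rho>_def by simp
  qed
  then show ?thesis
    by (rule summable_Suc_iff[THEN iffD1])
qed

lemma convergent_link_product_component: "convergent (\<lambda>M. link_product \<pi> L S q x M $ i $ j)"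
proof (cases "j = one")
  case False
  then show ?thesis
    using summable_LIMSEQ_zero[OF summable_link_product_column] by (auto simp: convergent_def)
next
  case True
  let ?p = "\<lambda>M l. link_product \<pi> L S q x M $ i $ l"
  \<comment> \<open>The next entry of column \<open>one\<close> is the whole current row sum, so its
    increment is the sum of the other columns. These increments are summable and telescope.\<close>
  have "?p (Suc M) one - ?p M one = (\<Sum>l\<in>UNIV - {one}. ?p M l)" for M
    unfolding link_product_Suc_one by (subst sum.remove[of _ one]) auto
  then have "summable (\<lambda>M. ?p (Suc M) one - ?p M one)"
    by (simp only:) (intro summable_sum summable_link_product_column, simp)
  then have "convergent (\<lambda>M. \<Sum>m<M. ?p (Suc m) one - ?p m one)"
    by (simp only: summable_iff_convergent)
  then have "convergent (\<lambda>M. ?p M one - ?p 0 one)"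
    unfolding sum_lessThan_telescope[of "\<lambda>M. ?p M one"] .
  then show ?thesis
    using True convergent_diff_const_right_iff by blast
qed

lemma link_product_component_tendsto:
  "(\<lambda>M. link_product \<pi> L S q x M $ i $ j) \<longlonglongrightarrow> lim (\<lambda>M. link_product \<pi> L S q x M $ i $ j)"
  using convergent_link_product_component by (simp only: convergent_LIMSEQ_iff)

lemma convergent_link_product: "convergent (link_product \<pi> L S q x)"
proof -
  have "link_product \<pi> L S q x \<longlonglongrightarrow> (\<chi> i j. lim (\<lambda>M. link_product \<pi> L S q x M $ i $ j))"
    by (intro vec_tendstoI) (simp add: link_product_component_tendsto)
  then show ?thesis by (auto simp: convergent_def)
qed

text \<open>The row sum after \<open>M\<close> steps is the entry in column \<open>one\<close> after
  \<open>Suc M\<close> steps; the shift of index does not affect the limit.\<close>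

lemma sum_weight_chain_sums_tendsto:
  "(\<lambda>M. sum (weight q x) (X M (\<pi> k)))
     \<longlonglongrightarrow> weight q x (\<pi> k) * lim (link_product \<pi> L S q x) $ k $ one"
proof -
  have "link_product \<pi> L S q x \<longlonglongrightarrow> lim (link_product \<pi> L S q x)"
    using convergent_link_product by (simp only: convergent_LIMSEQ_iff)
  then have "(\<lambda>M. link_product \<pi> L S q x (Suc M) $ k $ one) \<longlonglongrightarrow> lim (link_product \<pi> L S q x) $ k $ one"
    by (intro tendsto_vec_nth LIMSEQ_Suc)
  then show ?thesis
    unfolding sum_weight_chain_sums link_product_Suc_one by (rule tendsto_mult_left)
qed

end

section \<open>From finite chain sums to the generating functions\<close>

lemma finite_subset_chain_sums:
  assumes "\<mu> \<in> P" "finite F" "F \<subseteq> ideal_with_tail P L S \<mu>"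
  shows "\<exists>M. F \<subseteq> X M \<mu>"
  using assms(2,3)
proof (induction F rule: finite_induct)
  case (insert \<kappa> F)
  then obtain M N where "\<kappa> \<in> X M \<mu>" "F \<subseteq> X N \<mu>"
    unfolding ideal_with_tail_eq[OF assms(1)] by auto
  then have "insert \<kappa> F \<subseteq> X (max M N) \<mu>"
    using chain_sums_mono[OF assms(1), of M "max M N"] chain_sums_mono[OF assms(1), of N "max M N"]
    by auto
  then show ?case by blast
qed simp

text \<open>The finite sets of chain sums are nested and eventually contain any given finite subset,
  so an unordered infinite sum over the ideal can be evaluated along them.\<close>

lemma filterlim_chain_sums:
  assumes "\<mu> \<in> P"
  shows "filterlim (\<lambda>M. X M \<mu>) (finite_subsets_at_top (ideal_with_tail P L S \<mu>)) sequentially"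
  unfolding filterlim_finite_subsets_at_top
proof (intro allI impI, elim conjE)
  fix F assume F: "finite F" "F \<subseteq> ideal_with_tail P L S \<mu>"
  then obtain M where "F \<subseteq> X M \<mu>"
    using finite_subset_chain_sums assms by blast
  then have "F \<subseteq> X N \<mu>" if "N \<ge> M" for N
    using chain_sums_mono[OF assms that] by blast
  then show "\<forall>\<^sub>F N in sequentially. finite (X N \<mu>) \<and> F \<subseteq> X N \<mu> \<and> X N \<mu> \<subseteq> ideal_with_tail P L S \<mu>"
    using finite_chain_sums[OF assms] unfolding ideal_with_tail_eq[OF assms] eventually_sequentially
    by blast
qed

lemma weight_summable_on_ideal_with_tail:
  assumes "norm q < 1" "norm (x * q) \<le> 1"
  shows "weight q x summable_on ideal_with_tail P L S (\<pi> k)"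
proof -
  have \<pi>: "\<pi> k \<in> P"
    by (simp add: P_eq)
  let ?q = "of_real (norm q) :: complex" and ?x = "of_real (norm x) :: complex"
  \<comment> \<open>The limit computation is applied at the moduli of \<open>q\<close> and
    \<open>x\<close>, where the partial sums are sums of absolute weights; convergence makes them
    bounded.\<close>
  have "Bseq (\<lambda>M. sum (weight ?q ?x) (X M (\<pi> k)))"
    using sum_weight_chain_sums_tendsto[of ?q ?x k] assms
    by (intro convergent_imp_Bseq) (auto simp: convergent_def norm_mult)
  then obtain B where B: "\<And>M. norm (sum (weight ?q ?x) (X M (\<pi> k))) \<le> B"
    unfolding Bseq_def by blast
  have "(\<lambda>\<kappa>. norm (weight q x \<kappa>)) summable_on ideal_with_tail P L S (\<pi> k)"
  proof (rule nonneg_bdd_above_summable_on)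
    show "bdd_above (sum (\<lambda>\<kappa>. norm (weight q x \<kappa>)) ` {F. F \<subseteq> ideal_with_tail P L S (\<pi> k) \<and> finite F})"
    proof (rule bdd_aboveI2)
      fix F assume "F \<in> {F. F \<subseteq> ideal_with_tail P L S (\<pi> k) \<and> finite F}"
      then obtain M where M: "F \<subseteq> X M (\<pi> k)"
        using finite_subset_chain_sums[OF \<pi>] by blast
      then have "(\<Sum>\<kappa>\<in>F. norm (weight q x \<kappa>)) \<le> (\<Sum>\<kappa>\<in>X M (\<pi> k). norm (weight q x \<kappa>))"
        using finite_chain_sums[OF \<pi>] by (intro sum_mono2) auto
      also have "\<dots> = norm (sum (weight ?q ?x) (X M (\<pi> k)))"
        unfolding norm_weight of_real_sum[symmetric] by (simp add: sum_nonneg del: of_real_sum)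
      also have "\<dots> \<le> B" by (rule B)
      finally show "(\<Sum>\<kappa>\<in>F. norm (weight q x \<kappa>)) \<le> B" .
    qed
  qed simp
  then show ?thesis
    by (rule abs_summable_summable)
qed

text \<open>Both sides are limits of the weight sums over \<open>X M (\<pi> k)\<close>: one by
  summability, the other by the matrix computation.\<close>

lemma gen_fun_ideal_with_tail:
  assumes "norm q < 1" "norm (x * q) \<le> 1"
  shows "gen_fun (ideal_with_tail P L S (\<pi> k)) q x =
    weight q x (\<pi> k) * lim (link_product \<pi> L S q x) $ k $ one"
proof (rule LIMSEQ_unique)
  have "(sum (weight q x) \<longlongrightarrow> gen_fun (ideal_with_tail P L S (\<pi> k)) q x)
      (finite_subsets_at_top (ideal_with_tail P L S (\<pi> k)))"
    using has_sum_infsum[OF weight_summable_on_ideal_with_tail[OF assms]]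
    by (simp add: has_sum_def gen_fun_def)
  then show "(\<lambda>M. sum (weight q x) (X M (\<pi> k))) \<longlonglongrightarrow> gen_fun (ideal_with_tail P L S (\<pi> k)) q x"
    by (rule filterlim_compose[OF _ filterlim_chain_sums]) (simp add: P_eq)
qed (rule sum_weight_chain_sums_tendsto[OF assms])

end

text \<open>Summability and convergence belong to the conclusion, since \<open>gen_fun\<close> and
  \<open>lim\<close> denote values even where the sum or the limit does not exist.\<close>

theorem theorem1p1:
  fixes P :: "nat multiset set"
    and \<pi> :: "'k::finite \<Rightarrow> nat multiset"
    and one :: 'k
    and L :: "nat multiset \<Rightarrow> nat multiset set"
    and S :: nat
    and q x :: complex
  assumes "inj \<pi>" and "P = range \<pi>"
    and "\<forall>\<mu>\<in>P. is_partition \<mu>"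
    and "\<pi> one = {#}"
    and "\<forall>k. L (\<pi> k) \<subseteq> P"
    and "\<forall>k. {#} \<in> L (\<pi> k)"
    and "L {#} = P"
    and "0 < S"
    and "\<forall>\<mu>\<in>P. \<forall>p\<in>#\<mu>. p \<le> S"
    and "norm q < 1"
    and "q \<noteq> 0 \<longrightarrow> norm x < inverse (norm q)"
  shows "(\<forall>k. weight q x summable_on ideal_with_tail P L S (\<pi> k)) \<and>
    convergent (link_product \<pi> L S q x) \<and>
    (\<chi> k. gen_fun (ideal_with_tail P L S (\<pi> k)) q x) =
      (weight_matrix \<pi> q x ** lim (link_product \<pi> L S q x)) *v axis one 1"
proof -
  interpret linked_ideal P \<pi> one L S
    using assms by unfold_locales auto
  \<comment> \<open>For \<open>q = 0\<close> the bound on \<open>x\<close> is vacuous, but the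
    product is then 0; otherwise it is the bound multiplied by \<open>norm q\<close>.\<close>
  have xq: "norm (x * q) \<le> 1"
    using assms(11) by (cases "q = 0") (auto simp: norm_mult field_simps)
  have "(\<chi> k. gen_fun (ideal_with_tail P L S (\<pi> k)) q x) =
      (weight_matrix \<pi> q x ** lim (link_product \<pi> L S q x)) *v axis one 1"
    by (simp add: vec_eq_iff gen_fun_ideal_with_tail[OF assms(10) xq]
        weight_matrix_mult_component matrix_vector_mult_def axis_def
        if_distrib[of "\<lambda>a. _ * a"] cong: if_cong)
  then show ?thesis
    using weight_summable_on_ideal_with_tail[OF assms(10) xq] convergent_link_product[OF assms(10) xq]
    by blast
qed

end
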